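(* Let $M>1$ be a real number, let $\gamma_i=M$ for all $i\in\mathbb{N}$, and suppose $$V_i(x)\le \gamma_i V_1(x)=M\,V_1(x)\qquad\text{for all }x\in\mathbb{X}\text{ and all }i\in\mathbb{N}.$$ Suppose also that there exist $\mathcal{K}_\infty$-functions $\underline\eta,\bar\eta$ with $\underline\eta(d_X(x,x^\star))\le V_1(x)$ and $V_N(x)\le\bar\eta(d_X(x,x^\star))$ for all $x\in\mathbb{X}$. Then asymptotic stability at $x^\star$ of the MPC closed loop with prediction horizon $N\ge2$ and control horizon $m$ (feedback $\mu_{N,m}$) is guaranteed in the following cases. (1) For $m=1$: if $$N\ge2+\frac{\ln(M-1)}{\ln(M)-\ln(M-1)};$$ thus, the minimal stabilizing prediction horizon $\hat N:=\min\{N: N\in\mathbb{N},\ N\ge2,\ \alpha_{N,m}\ge0\}$ grows asymptotically like $M\ln(M)$ as $M\to\infty$. (2) For $m=\lfloor N/2\rfloor$: if one of the following inequalities holds: $$N\ge\frac{2\ln(2)}{\ln(M)-\ln(M-1)}\quad (N\text{ even}),\qquad N\ge\frac{\ln\big(\frac{2M-1}{M}\big)+\ln\big(\frac{2M-1}{M-1}\big)}{\ln(M)-\ln(M-1)}\quad (N\text{ odd}).$$ In this case, the minimal stabilizing prediction horizon $\hat N:=\min\{N: N\in\mathbb{N},\ N\ge2,\ \alpha_{N,m}\ge0\}$ (with $m=\lfloor N/2\rfloor$) grows asymptotically like $2\ln(2)M$ as $M\to\infty$. By a monotonicity argument, these estimates also apply to each sequence $\Gamma=(\gamma_i)_{i\in\mathbb{N}}$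 which is bounded by $M$ (in place of the constant sequence $\gamma_i=M$).
   Context: Setting. $(X,d_X)$ and $(U,d_U)$ are metric spaces, $f:X\times U\to X$, and the control system is $x(n+1)=f(x(n),u(n))$. $\mathbb{X}\subseteq X$ and $\mathbb{U}\subseteq U$ are constraint sets. For $x\in\mathbb{X}$ and a control sequence $u$, $x_u(\cdot;x)$ denotes the trajectory with $x_u(0;x)=x$, $x_u(n+1;x)=f(x_u(n;x),u(n))$. $\mathcal{U}^N(x)$ is the set of admissible control sequences $(u(0),\ldots,u(N-1))$, i.e. those with $u(n)\in\mathbb{U}$ and $f(x_u(n;x),u(n))\in\mathbb{X}$ for $n=0,\ldots,N-1$. $x^\star\in\mathbb{X}$ is a controlled equilibrium: $f(x^\star,u^\star)=x^\star$ for some control value $u^\star$. The stage cost $\ell:X\times U\to[0,\infty)$ is continuous with $\ell(x^\star,u^\star)=0$ and $\ell(x,u)>0$ for all $u\in U$ and all $x\ne x^\star$. Value functions. $J_N(x,u)=\sum_{n=0}^{N-1}\ell(x_u(n;x),u(n))$, $V_N(x)=\inf_{u\in\mathcal{U}^N(x)}J_N(x,u)$. Standing assumption: for each $x\in\mathbb{X}$ and each $N\in\mathbb{N}$ the set $\mathcal{U}^N(x)$ is nonempty and a minimizer of $J_N(x,\cdot)$ over $\mathcal{U}^N(x)$ exists. MPC multistep feedback. For $N\ge2$ and $m\in\{1,\ldots,N-1\}$ choose for each $x\in\mathbb{X}$ a minimizer $u^\star(\cdot;x)\in\mathcal{U}^N(x)$ of $J_N(x,\cdot)$ and set $\mu_{N,m}(x,n)=u^\star(n;x)$,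 $n=0,\ldots,m-1$. With $\mu=\mu_{N,m}$ and $\varphi(n)=\max\{km: k\in\mathbb{N}_0,\ km\le n\}$, the MPC closed loop is $x_\mu(0;x)=x$, $x_\mu(n+1;x)=f\big(x_\mu(n;x),\mu(x_\mu(\varphi(n);x),n-\varphi(n))\big)$. Suboptimality index. For a sequence $(\gamma_i)_{i\in\mathbb{N}}$, $$\alpha_{N,m}:=1-\frac{\prod_{i=m+1}^N(\gamma_i-1)\ \prod_{i=N-m+1}^N(\gamma_i-1)}{\Big[\prod_{i=m+1}^N\gamma_i-\prod_{i=m+1}^N(\gamma_i-1)\Big]\Big[\prod_{i=N-m+1}^N\gamma_i-\prod_{i=N-m+1}^N(\gamma_i-1)\Big]}.$$ Asymptotic stability of the closed loop at $x^\star$ means: for every $\varepsilon>0$ there is $\delta>0$ such that $d_X(x_\mu(n;x),x^\star)<\varepsilon$ for all $n\in\mathbb{N}_0$ and all $x\in\mathbb{X}$ with $d_X(x,x^\star)<\delta$; and $x_\mu(n;x)\to x^\star$ as $n\to\infty$ for every $x\in\mathbb{X}$. A $\mathcal{K}_\infty$-function is a continuous, strictly increasing, unbounded $\rho:[0,\infty)\to[0,\infty)$ with $\rho(0)=0$.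
   Formalization: At equality N = bound only stability and α_{N,m} ≥ 0 are asserted; asymptotic stability is stated for strict inequality, as equality fails (e.g. M=N=2, m=1). For sequences Γ, the claims on α_{N,m} and N̂ assume γ_i ≥ 1. *)

theory Defs
  imports "HOL-Analysis.Analysis" "HOL-Library.Landau_Symbols"
begin

(* Control sequences are total functions nat => 'u; with horizon N only the values at 0, ..., N - 1
   enter the admissibility condition and the cost. *)

primrec trajectory :: "('x \<Rightarrow> 'u \<Rightarrow> 'x) \<Rightarrow> 'x \<Rightarrow> (nat \<Rightarrow> 'u) \<Rightarrow> nat \<Rightarrow> 'x" where
  "trajectory f x u 0 = x"
| "trajectory f x u (Suc n) = f (trajectory f x u n) (u n)"

definition admissible ::
    "('x \<Rightarrow> 'u \<Rightarrow> 'x) \<Rightarrow> 'x set \<Rightarrow> 'u set \<Rightarrow> nat \<Rightarrow> 'x \<Rightarrow> (nat \<Rightarrow> 'u) set" where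
  "admissible f XX UU N x = {u. \<forall>n<N. u n \<in> UU \<and> f (trajectory f x u n) (u n) \<in> XX}"

definition cost ::
    "('x \<Rightarrow> 'u \<Rightarrow> 'x) \<Rightarrow> ('x \<Rightarrow> 'u \<Rightarrow> real) \<Rightarrow> nat \<Rightarrow> 'x \<Rightarrow> (nat \<Rightarrow> 'u) \<Rightarrow> real" where
  "cost f l N x u = (\<Sum>n<N. l (trajectory f x u n) (u n))"

definition optimal_value ::
    "('x \<Rightarrow> 'u \<Rightarrow> 'x) \<Rightarrow> ('x \<Rightarrow> 'u \<Rightarrow> real) \<Rightarrow> 'x set \<Rightarrow> 'u set \<Rightarrow> nat \<Rightarrow> 'x \<Rightarrow> real" where
  "optimal_value f l XX UU N x = (INF u\<in>admissible f XX UU N x. cost f l N x u)"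

definition optimal_control ::
    "('x \<Rightarrow> 'u \<Rightarrow> 'x) \<Rightarrow> ('x \<Rightarrow> 'u \<Rightarrow> real) \<Rightarrow> 'x set \<Rightarrow> 'u set \<Rightarrow> nat \<Rightarrow> 'x \<Rightarrow> (nat \<Rightarrow> 'u) \<Rightarrow> bool" where
  "optimal_control f l XX UU N x u \<longleftrightarrow>
     u \<in> admissible f XX UU N x \<and> (\<forall>v\<in>admissible f XX UU N x. cost f l N x u \<le> cost f l N x v)"

(* mu is a feedback obtained by some choice of minimizers, one for each state in XX. *)
definition mpc_feedback ::
    "('x \<Rightarrow> 'u \<Rightarrow> 'x) \<Rightarrow> ('x \<Rightarrow> 'u \<Rightarrow> real) \<Rightarrow> 'x set \<Rightarrow> 'u set \<Rightarrow> nat \<Rightarrow> nat \<Rightarrow>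
     ('x \<Rightarrow> nat \<Rightarrow> 'u) \<Rightarrow> bool" where
  "mpc_feedback f l XX UU N m \<mu> \<longleftrightarrow>
     (\<forall>x\<in>XX. \<exists>u. optimal_control f l XX UU N x u \<and> (\<forall>n<m. \<mu> x n = u n))"

definition last_update :: "nat \<Rightarrow> nat \<Rightarrow> nat" where
  "last_update m n = Max {k * m |k. k * m \<le> n}"

lemma last_update_le: "last_update m n \<le> n"
proof -
  have fin: "finite {k * m |k. k * m \<le> n}"
    by (rule finite_subset[of _ "{..n}"]) auto
  have "0 * m \<in> {k * m |k. k * m \<le> n}"
    by (rule CollectI, rule exI[of _ 0]) simp
  with fin have "Max {k * m |k. k * m \<le> n} \<in> {k * m |k. k * m \<le> n}"
    by (intro Max_in) auto
  then show ?thesis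
    unfolding last_update_def by auto
qed

function closed_loop ::
    "('x \<Rightarrow> 'u \<Rightarrow> 'x) \<Rightarrow> ('x \<Rightarrow> nat \<Rightarrow> 'u) \<Rightarrow> nat \<Rightarrow> 'x \<Rightarrow> nat \<Rightarrow> 'x" where
  "closed_loop f \<mu> m x 0 = x"
| "closed_loop f \<mu> m x (Suc n) =
     f (closed_loop f \<mu> m x n)
       (\<mu> (closed_loop f \<mu> m x (last_update m n)) (n - last_update m n))"
  by pat_completeness auto
termination
  by (relation "Wellfounded.measure (\<lambda>(f, \<mu>, m, x, n). n)") (auto simp: last_update_le less_Suc_eq_le)

definition stable_at :: "'x::metric_space set \<Rightarrow> 'x \<Rightarrow> ('x \<Rightarrow> nat \<Rightarrow> 'x) \<Rightarrow> bool" where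
  "stable_at XX xs traj \<longleftrightarrow>
     (\<forall>\<epsilon>>0. \<exists>\<delta>>0. \<forall>x\<in>XX. dist x xs < \<delta> \<longrightarrow> (\<forall>n. dist (traj x n) xs < \<epsilon>))"

definition asymptotically_stable_at ::
    "'x::metric_space set \<Rightarrow> 'x \<Rightarrow> ('x \<Rightarrow> nat \<Rightarrow> 'x) \<Rightarrow> bool" where
  "asymptotically_stable_at XX xs traj \<longleftrightarrow>
     stable_at XX xs traj \<and> (\<forall>x\<in>XX. traj x \<longlonglongrightarrow> xs)"

(* Only the restriction of \<rho> to the nonnegative reals matters; it maps into the
   nonnegative reals because it is increasing with \<rho> 0 = 0. *)
definition K_infinity :: "(real \<Rightarrow> real) \<Rightarrow> bool" where
  "K_infinity \<rho> \<longleftrightarrow>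
     continuous_on {0..} \<rho> \<and> strict_mono_on {0..} \<rho> \<and> \<not> bdd_above (\<rho> ` {0..}) \<and> \<rho> 0 = 0"

definition subopt_index :: "(nat \<Rightarrow> real) \<Rightarrow> nat \<Rightarrow> nat \<Rightarrow> real" where
  "subopt_index \<gamma> N m =
     1 - ((\<Prod>i=m+1..N. \<gamma> i - 1) * (\<Prod>i=N-m+1..N. \<gamma> i - 1)) /
         (((\<Prod>i=m+1..N. \<gamma> i) - (\<Prod>i=m+1..N. \<gamma> i - 1)) *
          ((\<Prod>i=N-m+1..N. \<gamma> i) - (\<Prod>i=N-m+1..N. \<gamma> i - 1)))"

(* The control horizon is given as a function of the prediction horizon N. *)
definition min_horizon :: "(nat \<Rightarrow> real) \<Rightarrow> (nat \<Rightarrow> nat) \<Rightarrow> nat" where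
  "min_horizon \<gamma> m = (LEAST N. 2 \<le> N \<and> 0 \<le> subopt_index \<gamma> N (m N))"

definition one_step_bound :: "real \<Rightarrow> real" where
  "one_step_bound M = 2 + ln (M - 1) / (ln M - ln (M - 1))"

definition half_horizon_bound :: "real \<Rightarrow> nat \<Rightarrow> real" where
  "half_horizon_bound M N =
     (if even N then 2 * ln 2 / (ln M - ln (M - 1))
      else (ln ((2 * M - 1) / M) + ln ((2 * M - 1) / (M - 1))) / (ln M - ln (M - 1)))"

(* For constant \<gamma> = M, equality in these bounds means that subopt_index vanishes.  The value
   function is then only known to be nonincreasing along the closed loop, which yields stability
   but not attractivity.  Example with M = N = 2, m = 1: on the nonnegative reals take
   f x u = u * min x ((x + 1) / 2), controls in {0, 1} and l x u = |x| * (1 + (u - 1)^2).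
   The value functions satisfy V i x <= 2 * x = 2 * V 1 x, while the closed loop started at 3
   converges to 1 instead of the equilibrium 0.  So asymptotic stability is only claimed under
   the strict inequalities. *)

end

theory Submission
  imports Defs "HOL-Real_Asymp.Real_Asymp"
begin

text \<open>
  Let S k be the part of the optimal cost V N x that accrues from time k on, along an optimal
  trajectory. The tail of an optimal control is optimal, so the bound V i \<le> M V 1 gives
  S k \<le> M (S k - S (k + 1)), that is, S contracts by the factor q = (M - 1) / M. The same bound,
  applied at time k \<ge> m, controls the excess D = V N (x m) - S m by
  S (k + 1) + D \<le> q (S k + D). As S N = 0, combining the two yields
  V N (x m) \<le> V N x - \<alpha> J m with \<alpha> the suboptimality index; hence V N does not increase along
  the closed loop, and for \<alpha> > 0 the sum of the values V 1 along the closed loop is finite.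
  Dividing numerator and denominator of the index by the products of the \<gamma> i turns \<alpha> \<ge> 0 into
  q ^ m + q ^ (N - m) \<le> 1, from which the horizon bounds follow by taking logarithms.
\<close>

section \<open>Dynamic programming\<close>

lemma trajectory_add:
  "trajectory f x u (j + k) = trajectory f (trajectory f x u j) (\<lambda>i. u (j + i)) k"
  by (induction k) auto

lemma trajectory_cong:
  assumes "\<And>i. i < n \<Longrightarrow> u i = v i"
  shows "trajectory f x u n = trajectory f x v n"
  using assms by (induction n) auto

lemma cost_add:
  "cost f l (j + k) x u = cost f l j x u + cost f l k (trajectory f x u j) (\<lambda>i. u (j + i))"
  by (induction k) (auto simp: cost_def trajectory_add)

lemma cost_cong:
  assumes "\<And>i. i < n \<Longrightarrow> u i = v i"
  shows "cost f l n x u = cost f l n x v"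
  unfolding cost_def
proof (rule sum.cong)
  fix k assume "k \<in> {..<n}"
  with assms show "l (trajectory f x u k) (u k) = l (trajectory f x v k) (v k)"
    using trajectory_cong[of k u v f x] by simp
qed simp

lemma admissible_cong:
  assumes "\<And>i. i < n \<Longrightarrow> u i = v i"
  shows "u \<in> admissible f XX UU n x \<longleftrightarrow> v \<in> admissible f XX UU n x"
proof -
  have "trajectory f x u k = trajectory f x v k" if "k < n" for k
    using that assms by (intro trajectory_cong) auto
  then show ?thesis
    using assms by (simp add: admissible_def)
qed

lemma admissible_add:
  "u \<in> admissible f XX UU (j + k) x \<longleftrightarrow>
     u \<in> admissible f XX UU j x \<and>
     (\<lambda>i. u (j + i)) \<in> admissible f XX UU k (trajectory f x u j)"
proof -
  have "(\<forall>n<j + k. P n) \<longleftrightarrow> (\<forall>n<j. P n) \<and> (\<forall>n<k. P (j + n))" for P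
    by (metis add_less_cancel_left le_add_diff_inverse not_less trans_less_add1)
  then show ?thesis
    unfolding admissible_def mem_Collect_eq trajectory_add[symmetric] .
qed

lemma trajectory_in_constraints:
  assumes "x \<in> XX" "u \<in> admissible f XX UU n x" "k \<le> n"
  shows "trajectory f x u k \<in> XX"
  using assms by (cases k) (auto simp: admissible_def)

section \<open>Value functions and the principle of optimality\<close>

locale control_problem =
  fixes f :: "'x \<Rightarrow> 'u \<Rightarrow> 'x" and l :: "'x \<Rightarrow> 'u \<Rightarrow> real"
    and XX :: "'x set" and UU :: "'u set"
  assumes l_nonneg: "0 \<le> l x u"
    and minimizer_exists: "x \<in> XX \<Longrightarrow> 1 \<le> i \<Longrightarrow> \<exists>u. optimal_control f l XX UU i x u"
begin

abbreviation "V \<equiv> optimal_value f l XX UU"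
abbreviation "J \<equiv> cost f l"
abbreviation "traj \<equiv> trajectory f"
abbreviation "adm \<equiv> admissible f XX UU"
abbreviation "optimal \<equiv> optimal_control f l XX UU"

lemma cost_nonneg: "0 \<le> J n x u"
  unfolding cost_def by (intro sum_nonneg l_nonneg)

text \<open>Nonnegative costs bound the image set below by 0, without which the real
  \<open>INF\<close> would carry no information.\<close>

lemma value_le_cost:
  assumes "u \<in> adm n x"
  shows "V n x \<le> J n x u"
  unfolding optimal_value_def using assms cost_nonneg
  by (intro cINF_lower bdd_belowI2[of _ 0]) auto

lemma value_eq_cost:
  assumes "optimal n x u"
  shows "V n x = J n x u"
proof (rule antisym)
  show "V n x \<le> J n x u"
    using assms by (intro value_le_cost) (simp add: optimal_control_def)
  show "J n x u \<le> V n x"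
    unfolding optimal_value_def using assms
    by (intro cINF_greatest) (auto simp: optimal_control_def)
qed

lemma value_nonneg:
  assumes "x \<in> XX" "1 \<le> n"
  shows "0 \<le> V n x"
  using minimizer_exists[OF assms] value_eq_cost cost_nonneg by metis

text \<open>Following \<open>u\<close> for \<open>j\<close> steps and then an optimal control of the
  state reached is admissible for the whole horizon, and its cost is the right-hand side.\<close>

lemma value_add_le:
  assumes "x \<in> XX" "u \<in> adm j x" "1 \<le> k"
  shows "V (j + k) x \<le> J j x u + V k (traj x u j)"
proof -
  have "traj x u j \<in> XX"
    using trajectory_in_constraints[OF assms(1,2)] by simp
  then obtain v where v: "optimal k (traj x u j) v"
    using minimizer_exists assms(3) by blast
  define w where "w i = (if i < j then u i else v (i - j))" for i
  have w: "\<And>i. i < j \<Longrightarrow> w i = u i" "(\<lambda>i. w (j + i)) = v"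
    by (auto simp: w_def)
  have traj: "traj x w j = traj x u j"
    by (intro trajectory_cong w)
  have "w \<in> adm j x"
    using assms(2) by (subst admissible_cong[where v = u]) (auto simp: w)
  then have "w \<in> adm (j + k) x"
    using v w(2) by (simp add: admissible_add traj optimal_control_def)
  then have "V (j + k) x \<le> J (j + k) x w"
    by (rule value_le_cost)
  also have "\<dots> = J j x u + V k (traj x u j)"
    unfolding cost_add traj w(2) value_eq_cost[OF v] using cost_cong[of j w u] w(1) by simp
  finally show ?thesis .
qed

text \<open>Tails of optimal controls are optimal: by \<open>value_add_le\<close>, a cheaper
  continuation could be glued to the head and would beat \<open>u\<close>.\<close>

lemma tail_cost_eq_value:
  assumes "x \<in> XX" "optimal (j + k) x u" "1 \<le> k"
  shows "J (j + k) x u - J j x u = V k (traj x u j)"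
proof -
  have u: "u \<in> adm j x" "(\<lambda>i. u (j + i)) \<in> adm k (traj x u j)"
    using assms(2) by (auto simp: optimal_control_def admissible_add)
  show ?thesis
    using value_le_cost[OF u(2)] value_add_le[OF assms(1) u(1) assms(3)]
      value_eq_cost[OF assms(2)] cost_add[of f l j k x u] by simp
qed

text \<open>This makes the hypothesis \<open>V i y \<le> M * V 1 y\<close> usable along a
  trajectory: it becomes a bound by \<open>M\<close> times one stage cost, that is, by a decrement
  of the cost to go.\<close>

lemma value_one_le_stage_cost:
  assumes "u \<in> adm n x" "k < n"
  shows "V 1 (traj x u k) \<le> l (traj x u k) (u k)"
proof -
  \<comment> \<open>The horizon is split into the past, the single step at \<open>k\<close> and the
    rest, so that \<open>admissible_add\<close> isolates the middle part.\<close>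
  have "u \<in> adm (k + (1 + (n - k - 1))) x"
    using assms by simp
  then have "(\<lambda>i. u (k + i)) \<in> adm 1 (traj x u k)"
    unfolding admissible_add by blast
  from value_le_cost[OF this] show ?thesis
    by (simp add: cost_def)
qed

end

text \<open>Before time \<open>m\<close> the sequence \<open>S\<close> contracts, and from
  \<open>m\<close> on the shifted sequence \<open>S + D\<close> does, both by the factor
  \<open>q\<close>. The first fact bounds \<open>S m\<close> by the decrement
  \<open>S 0 - S m\<close>, the second bounds \<open>D\<close> by \<open>S m\<close>.\<close>

lemma tail_contraction:
  fixes S :: "nat \<Rightarrow> real" and q D M :: real
  assumes "q = (M - 1) / M" "1 < M" "m < N" "S N = 0"
    and head: "\<And>k. k < m \<Longrightarrow> S (Suc k) \<le> q * S k"
    and tail: "\<And>k. m \<le> k \<Longrightarrow> k < N \<Longrightarrow> D \<le> (M - 1) * S k - M * S (Suc k)"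
  shows "(1 - q ^ m) * (1 - q ^ (N - m)) * D \<le> q ^ N * (S 0 - S m)"
proof -
  have q: "0 < q" "q < 1" and M: "M * (1 - q) = 1"
    using \<open>1 < M\<close> unfolding assms(1) by (auto simp: field_simps)
  have "k \<le> m \<Longrightarrow> S k \<le> q ^ k * S 0" for k
  proof (induction k)
    case (Suc k)
    then have "q * S k \<le> q * (q ^ k * S 0)"
      using q by (intro mult_left_mono) auto
    then show ?case
      using head[of k] Suc.prems by (simp add: mult.assoc)
  qed simp
  \<comment> \<open>Subtracting \<open>q ^ m * S m\<close> on both sides replaces the total
    \<open>S 0\<close> by the part spent up to time \<open>m\<close>.\<close>
  from this[of m] have S0: "(1 - q ^ m) * S m \<le> q ^ m * (S 0 - S m)"
    by (simp add: algebra_simps)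
  \<comment> \<open>Since \<open>M * q = M - 1\<close> and \<open>M * (1 - q) = 1\<close>, division
    of \<open>tail\<close> by \<open>M\<close> gives
    \<open>(1 - q) * D \<le> q * S k - S (Suc k)\<close>.\<close>
  have step: "S (Suc k) + D \<le> q * (S k + D)" if "m \<le> k" "k < N" for k
  proof -
    have "M * q = M - 1"
      using M by (simp add: algebra_simps)
    then have "(M - 1) * S k - M * S (Suc k) = M * (q * S k - S (Suc k))"
      by (simp add: right_diff_distrib mult.assoc[symmetric])
    then have "M * ((1 - q) * D) \<le> M * (q * S k - S (Suc k))"
      using tail[OF that] M by (simp add: mult.assoc[symmetric])
    then have "(1 - q) * D \<le> q * S k - S (Suc k)"
      using assms(2) by simp
    then show ?thesis
      by (simp add: algebra_simps)
  qed
  have "m + j \<le> N \<Longrightarrow> S (m + j) + D \<le> q ^ j * (S m + D)" for j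
  proof (induction j)
    case (Suc j)
    then have "q * (S (m + j) + D) \<le> q * (q ^ j * (S m + D))"
      using q by (intro mult_left_mono) auto
    then show ?case
      using step[of "m + j"] Suc.prems by (simp add: mult.assoc)
  qed simp
  \<comment> \<open>At the end of the horizon \<open>S N = 0\<close>, so only \<open>D\<close>
    remains on the left.\<close>
  from this[of "N - m"] have "(1 - q ^ (N - m)) * D \<le> q ^ (N - m) * S m"
    using assms(3,4) by (simp add: algebra_simps)
  then have "(1 - q ^ m) * ((1 - q ^ (N - m)) * D) \<le> (1 - q ^ m) * (q ^ (N - m) * S m)"
    using q by (intro mult_left_mono) (auto simp: power_le_one)
  also have "\<dots> = q ^ (N - m) * ((1 - q ^ m) * S m)"
    by simp
  also have "\<dots> \<le> q ^ (N - m) * (q ^ m * (S 0 - S m))"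
    using q S0 by (intro mult_left_mono) auto
  also have "\<dots> = q ^ N * (S 0 - S m)"
    using assms(3) by (simp add: power_add[symmetric] mult.assoc[symmetric])
  finally show ?thesis
    by (simp add: mult.assoc)
qed

section \<open>The suboptimality index\<close>

text \<open>Pulling \<gamma> i out of each factor \<open>\<gamma> i - 1\<close> leaves products of
  \<open>1 - 1 / \<gamma> i\<close>, which are monotone in the sequence; the common positive
  products cancel.\<close>

lemma subopt_index_eq:
  fixes \<gamma> :: "nat \<Rightarrow> real" and N m :: nat
  defines "r \<equiv> \<Prod>i=m+1..N. 1 - 1 / \<gamma> i"
    and "s \<equiv> \<Prod>i=N-m+1..N. 1 - 1 / \<gamma> i"
  assumes "\<And>i. 1 \<le> i \<Longrightarrow> 1 \<le> \<gamma> i"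
  shows "subopt_index \<gamma> N m = 1 - r * s / ((1 - r) * (1 - s))"
proof -
  have split: "(\<Prod>i=k+1..N. \<gamma> i - 1) = (\<Prod>i=k+1..N. \<gamma> i) * (\<Prod>i=k+1..N. 1 - 1 / \<gamma> i)"
    and pos: "(\<Prod>i=k+1..N. \<gamma> i) > 0" for k
  proof -
    have "\<gamma> i > 0" if "i \<in> {k+1..N}" for i
      using assms(3)[of i] that by simp
    then show "(\<Prod>i=k+1..N. \<gamma> i) > 0"
      by (intro prod_pos) auto
    show "(\<Prod>i=k+1..N. \<gamma> i - 1) = (\<Prod>i=k+1..N. \<gamma> i) * (\<Prod>i=k+1..N. 1 - 1 / \<gamma> i)"
      unfolding prod.distrib[symmetric]
    proof (rule prod.cong)
      fix i assume "i \<in> {k+1..N}"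
      then have "\<gamma> i > 0"
        using \<open>\<And>i. i \<in> {k+1..N} \<Longrightarrow> \<gamma> i > 0\<close> by blast
      then show "\<gamma> i - 1 = \<gamma> i * (1 - 1 / \<gamma> i)"
        by (simp add: field_simps)
    qed simp
  qed
  \<comment> \<open>If \<open>r\<close> or \<open>s\<close> equals 1, as for an empty product, both
    denominators vanish and both quotients are 0 by convention.\<close>
  have cancel: "(a * r) * (b * s) / ((a - a * r) * (b - b * s)) = r * s / ((1 - r) * (1 - s))"
    if "a > 0" "b > 0" for a b :: real
  proof -
    have "(a * r) * (b * s) = (a * b) * (r * s)"
      "(a - a * r) * (b - b * s) = (a * b) * ((1 - r) * (1 - s))"
      by (auto simp: algebra_simps)
    moreover have "a * b \<noteq> 0"
      using that by simp
    ultimately show ?thesis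
      by (metis mult_divide_mult_cancel_left)
  qed
  show ?thesis
    unfolding subopt_index_def split r_def[symmetric] s_def[symmetric]
    by (simp only: cancel[OF pos pos])
qed

text \<open>The product from \<open>m + 1\<close> has \<open>N - m\<close> factors and the one from
  \<open>N - m + 1\<close> has \<open>m\<close>, so the numerator collects
  \<open>q ^ N\<close>.\<close>

lemma subopt_index_const:
  fixes M q :: real
  assumes "1 < M" "q = (M - 1) / M" "m < N"
  shows "subopt_index (\<lambda>_. M) N m = 1 - q ^ N / ((1 - q ^ m) * (1 - q ^ (N - m)))"
proof -
  have "q = 1 - 1 / M"
    using assms by (simp add: field_simps)
  then show ?thesis
    using assms by (subst subopt_index_eq) (auto simp: power_add[symmetric] mult.commute)
qed

text \<open>The denominator is positive and expands to \<open>1 - r - s + r * s\<close>, so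
  \<open>r * s\<close> cancels.\<close>

lemma relaxation_factor_le_one_iff:
  fixes r s :: real
  assumes "r < 1" "s < 1"
  shows "r * s / ((1 - r) * (1 - s)) \<le> 1 \<longleftrightarrow> r + s \<le> 1"
    and "r * s / ((1 - r) * (1 - s)) < 1 \<longleftrightarrow> r + s < 1"
proof -
  have "(1 - r) * (1 - s) > 0"
    using assms by simp
  then show "r * s / ((1 - r) * (1 - s)) \<le> 1 \<longleftrightarrow> r + s \<le> 1"
    and "r * s / ((1 - r) * (1 - s)) < 1 \<longleftrightarrow> r + s < 1"
    by (simp_all add: divide_simps) (auto simp: algebra_simps)
qed

lemma subopt_index_const_sign:
  fixes M q :: real
  assumes "1 < M" "q = (M - 1) / M" "1 \<le> m" "m < N"
  shows "0 \<le> subopt_index (\<lambda>_. M) N m \<longleftrightarrow> q ^ m + q ^ (N - m) \<le> 1"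
    and "0 < subopt_index (\<lambda>_. M) N m \<longleftrightarrow> q ^ m + q ^ (N - m) < 1"
proof -
  have "0 < q" "q < 1"
    unfolding assms(2) using assms(1) by auto
  then have less: "q ^ m < 1" "q ^ (N - m) < 1"
    using assms by (auto simp: power_less_one_iff)
  have "q ^ m * q ^ (N - m) = q ^ N"
    using assms by (simp add: power_add[symmetric])
  then show "0 \<le> subopt_index (\<lambda>_. M) N m \<longleftrightarrow> q ^ m + q ^ (N - m) \<le> 1"
    and "0 < subopt_index (\<lambda>_. M) N m \<longleftrightarrow> q ^ m + q ^ (N - m) < 1"
    using relaxation_factor_le_one_iff[OF less] subopt_index_const[OF assms(1,2,4)] by auto
qed

text \<open>Only signs are compared: the criterion \<open>r + s \<le> 1\<close> is monotone in both
  products, and these grow when each \<gamma> i is raised to \<open>M\<close>. The bound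
  \<open>1 \<le> \<gamma> i\<close> keeps all factors nonnegative.\<close>

lemma subopt_index_nonneg_mono:
  fixes \<gamma> :: "nat \<Rightarrow> real" and M :: real
  assumes "1 < M" "1 \<le> m" "m < N"
    and \<gamma>: "\<And>i. 1 \<le> i \<Longrightarrow> 1 \<le> \<gamma> i" "\<And>i. 1 \<le> i \<Longrightarrow> \<gamma> i \<le> M"
    and nonneg: "0 \<le> subopt_index (\<lambda>_. M) N m"
  shows "0 \<le> subopt_index \<gamma> N m"
proof -
  define q where "q = (M - 1) / M"
  have q: "0 < q" "q < 1" "q = 1 - 1 / M"
    using assms by (auto simp: field_simps q_def)
  have le: "(\<Prod>i=k+1..N. 1 - 1 / \<gamma> i) \<le> q ^ (N - k)" for k
  proof -
    have "(\<Prod>i=k+1..N. 1 - 1 / \<gamma> i) \<le> (\<Prod>i=k+1..N. q)"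
    proof (rule prod_mono)
      fix i assume "i \<in> {k+1..N}"
      then have "1 \<le> \<gamma> i" "\<gamma> i \<le> M"
        using \<gamma> by auto
      then show "0 \<le> 1 - 1 / \<gamma> i \<and> 1 - 1 / \<gamma> i \<le> q"
        unfolding q(3) by (simp add: frac_le)
    qed
    then show ?thesis
      by simp
  qed
  have less: "q ^ m < 1" "q ^ (N - m) < 1"
    using assms q by (auto simp: power_less_one_iff)
  define r where "r = (\<Prod>i=m+1..N. 1 - 1 / \<gamma> i)"
  define s where "s = (\<Prod>i=N-m+1..N. 1 - 1 / \<gamma> i)"
  have rs: "r \<le> q ^ (N - m)" "s \<le> q ^ m"
    using le[of m] le[of "N - m"] assms(3) by (auto simp: r_def s_def)
  have "r + s \<le> 1"
    using rs nonneg subopt_index_const_sign(1)[OF assms(1) q_def assms(2,3)] by simp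
  then show ?thesis
    using relaxation_factor_le_one_iff(1)[of r s] less rs
      subopt_index_eq[of \<gamma> N m, OF \<gamma>(1), folded r_def s_def] by simp
qed

section \<open>The relaxed dynamic programming inequality\<close>

context control_problem
begin

text \<open>An instance of \<open>tail_contraction\<close>, with \<open>S k\<close> the cost to go
  of \<open>u\<close> from time \<open>k\<close> and \<open>D\<close> the excess of the new optimal
  value over the rest of the old cost.\<close>

lemma relaxed_dynamic_programming:
  fixes M :: real
  assumes x: "x \<in> XX" and u: "optimal N x u" and "1 < M" "1 \<le> m" "m < N"
    and bound: "\<And>i y. 1 \<le> i \<Longrightarrow> y \<in> XX \<Longrightarrow> V i y \<le> M * V 1 y"
  shows "V N (traj x u m) + subopt_index (\<lambda>_. M) N m * J m x u \<le> V N x"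
proof -
  define q where "q = (M - 1) / M"
  define S where "S k = J N x u - J k x u" for k
  define D where "D = V N (traj x u m) - S m"
  have adm: "u \<in> adm N x"
    using u by (simp add: optimal_control_def)
  have stage: "S k - S (Suc k) = l (traj x u k) (u k)" for k
    by (simp add: S_def cost_def)
  have later: "traj x u k \<in> XX" if "k \<le> N" for k
    using trajectory_in_constraints[OF x adm that] .
  have cost_to_go: "V i (traj x u k) \<le> M * (S k - S (Suc k))" if "k < N" "1 \<le> i" for i k
  proof -
    have "V i (traj x u k) \<le> M * V 1 (traj x u k)"
      using that later by (intro bound) auto
    also have "\<dots> \<le> M * l (traj x u k) (u k)"
      using value_one_le_stage_cost[OF adm \<open>k < N\<close>] \<open>1 < M\<close> by simp
    finally show ?thesis
      by (simp add: stage)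
  qed
  have "(1 - q ^ m) * (1 - q ^ (N - m)) * D \<le> q ^ N * (S 0 - S m)"
  proof (rule tail_contraction[OF q_def \<open>1 < M\<close> \<open>m < N\<close>])
    show "S N = 0"
      by (simp add: S_def)
    fix k
    show "S (Suc k) \<le> q * S k" if "k < m"
    proof -
      have "k < N"
        using that \<open>m < N\<close> by simp
      have "S k = V (N - k) (traj x u k)"
        using tail_cost_eq_value[of x k "N - k" u] x u \<open>k < N\<close> by (simp add: S_def)
      also have "\<dots> \<le> M * (S k - S (Suc k))"
        using \<open>k < N\<close> by (intro cost_to_go) auto
      finally show ?thesis
        using \<open>1 < M\<close> by (simp add: q_def field_simps)
    qed
    show "D \<le> (M - 1) * S k - M * S (Suc k)" if "m \<le> k" "k < N"
    proof -
      let ?y = "traj x u m" and ?v = "\<lambda>i. u (m + i)"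
      obtain j where k: "k = m + j"
        using le_Suc_ex[OF \<open>m \<le> k\<close>] by blast
      have "u \<in> adm (m + (j + (N - k))) x"
        using adm that k by simp
      then have "?v \<in> adm j ?y"
        by (simp add: admissible_add)
      \<comment> \<open>From the state at time \<open>m\<close>, the old control is kept until time
        \<open>k\<close> and then replaced. The remaining horizon \<open>N - j\<close> exceeds the
        \<open>N - k\<close> steps left of \<open>u\<close>, but the bound by \<open>M\<close> holds
        for every horizon.\<close>
      then have "V (j + (N - j)) ?y \<le> J j ?y ?v + V (N - j) (traj ?y ?v j)"
        using that k later by (intro value_add_le) auto
      also have "J j ?y ?v = S m - S k"
        by (simp add: S_def k cost_add)
      also have "traj ?y ?v j = traj x u k"
        by (simp add: k trajectory_add)
      also have "V (N - j) (traj x u k) \<le> M * (S k - S (Suc k))"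
        using that k by (intro cost_to_go) auto
      finally show ?thesis
        using that k by (simp add: D_def algebra_simps)
    qed
  qed
  moreover have "S 0 - S m = J m x u"
    by (simp add: S_def cost_def)
  moreover have "q ^ m < 1" "q ^ (N - m) < 1"
    using assms(3-5) by (auto simp: q_def power_less_one_iff)
  ultimately have "D \<le> q ^ N * J m x u / ((1 - q ^ m) * (1 - q ^ (N - m)))"
    by (subst pos_le_divide_eq) (auto simp: mult.commute)
  also have "\<dots> = (1 - subopt_index (\<lambda>_. M) N m) * J m x u"
    using subopt_index_const[OF \<open>1 < M\<close> q_def \<open>m < N\<close>] by simp
  also have "D = V N (traj x u m) + J m x u - V N x"
    by (simp add: D_def S_def value_eq_cost[OF u])
  finally show ?thesis
    by (simp add: algebra_simps)
qed

end

section \<open>The closed loop\<close>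

lemma last_update_eq:
  assumes "j < m"
  shows "last_update m (k * m + j) = k * m"
  unfolding last_update_def
proof (rule Max_eqI)
  show "finite {i * m |i. i * m \<le> k * m + j}"
    by (rule finite_subset[of _ "{..k * m + j}"]) auto
  show "k * m \<in> {i * m |i. i * m \<le> k * m + j}"
    by auto
  fix n assume "n \<in> {i * m |i. i * m \<le> k * m + j}"
  then obtain i where i: "n = i * m" "i * m \<le> k * m + j"
    by blast
  then have "i * m < Suc k * m"
    using assms by simp
  then have "i \<le> k"
    using mult_less_cancel2 less_Suc_eq_le by blast
  then show "n \<le> k * m"
    using i by simp
qed

text \<open>The case \<open>j = m\<close> is included: the state at the next update time is still
  produced by the old control, and the newly chosen one acts only one step later.\<close>

lemma closed_loop_segment:
  assumes "\<And>n. n < m \<Longrightarrow> \<mu> (closed_loop f \<mu> m x (k * m)) n = u n" "j \<le> m"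
  shows "closed_loop f \<mu> m x (k * m + j) = trajectory f (closed_loop f \<mu> m x (k * m)) u j"
  using assms(2)
proof (induction j)
  case (Suc j)
  then have "last_update m (k * m + j) = k * m"
    by (intro last_update_eq) simp
  then show ?case
    using Suc assms(1)[of j] by simp
qed simp

lemma sum_lessThan_add:
  "(\<Sum>i<a + b. g i) = (\<Sum>i<a. g i) + (\<Sum>i<b. g (a + i))"
  for g :: "nat \<Rightarrow> 'a::comm_monoid_add"
  by (induction b) (auto simp: add.assoc)

context control_problem
begin

text \<open>At update times \<open>V N\<close> decreases by
  \<open>relaxed_dynamic_programming\<close>, and the decrements telescope; in between,
  \<open>V 1\<close> is at most a single stage cost of the optimal control chosen at the last
  update, hence at most \<open>V N\<close> there.\<close>

lemma closed_loop_decrease: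
  fixes M :: real
  assumes \<mu>: "mpc_feedback f l XX UU N m \<mu>" and x: "x \<in> XX"
    and M: "1 < M" and m: "1 \<le> m" "m < N"
    and bound: "\<And>i y. 1 \<le> i \<Longrightarrow> y \<in> XX \<Longrightarrow> V i y \<le> M * V 1 y"
    and \<alpha>: "\<alpha> = subopt_index (\<lambda>_. M) N m" "0 \<le> \<alpha>"
  shows "V 1 (closed_loop f \<mu> m x n) \<le> V N x"
    and "closed_loop f \<mu> m x n \<in> XX"
    and "\<alpha> * (\<Sum>i<n * m. V 1 (closed_loop f \<mu> m x i)) \<le> V N x"
proof -
  let ?c = "closed_loop f \<mu> m x"
  have period: "?c (k * m + j) \<in> XX \<and> V 1 (?c (k * m + j)) \<le> V N (?c (k * m)) \<and>
      V N (?c (k * m + m)) + \<alpha> * (\<Sum>i<m. V 1 (?c (k * m + i))) \<le> V N (?c (k * m))"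
    if c: "?c (k * m) \<in> XX" and "j \<le> m" for k j
  proof -
    let ?y = "?c (k * m)"
    obtain u where u: "optimal N ?y u" and eq: "\<And>n. n < m \<Longrightarrow> \<mu> ?y n = u n"
      using \<mu> c unfolding mpc_feedback_def by blast
    have adm: "u \<in> adm N ?y"
      using u by (simp add: optimal_control_def)
    have seg: "?c (k * m + i) = traj ?y u i" if "i \<le> m" for i
      using closed_loop_segment[of m \<mu> f x k u] eq that by blast
    have V1: "V 1 (traj ?y u i) \<le> l (traj ?y u i) (u i)" if "i \<le> m" for i
      using that m by (intro value_one_le_stage_cost[OF adm]) auto
    \<comment> \<open>For \<open>j = m\<close> this uses \<open>m < N\<close>: time \<open>m\<close>
      still lies within the optimized horizon.\<close>
    have "V 1 (traj ?y u j) \<le> l (traj ?y u j) (u j)"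
      using V1 that(2) .
    also have "\<dots> \<le> J N ?y u"
      unfolding cost_def using that m by (intro member_le_sum l_nonneg) auto
    also have "\<dots> = V N ?y"
      by (simp add: value_eq_cost[OF u])
    finally have 1: "V 1 (?c (k * m + j)) \<le> V N ?y"
      using seg that(2) by simp
    have "(\<Sum>i<m. V 1 (?c (k * m + i))) \<le> J m ?y u"
      unfolding cost_def using V1 seg by (intro sum_mono) auto
    then have "\<alpha> * (\<Sum>i<m. V 1 (?c (k * m + i))) \<le> \<alpha> * J m ?y u"
      using \<alpha>(2) by (rule mult_left_mono)
    with relaxed_dynamic_programming[OF c u M m bound]
    have "V N (?c (k * m + m)) + \<alpha> * (\<Sum>i<m. V 1 (?c (k * m + i))) \<le> V N ?y"
      using seg[of m] \<alpha>(1) by simp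
    moreover have "?c (k * m + j) \<in> XX"
      using seg[OF that(2)] that m trajectory_in_constraints[OF c adm, of j] by simp
    ultimately show ?thesis
      using 1 by simp
  qed
  have updates: "?c (k * m) \<in> XX \<and> V N (?c (k * m)) + \<alpha> * (\<Sum>i<k * m. V 1 (?c i)) \<le> V N x" for k
  proof (induction k)
    case (Suc k)
    have "(\<Sum>i<Suc k * m. V 1 (?c i)) = (\<Sum>i<k * m. V 1 (?c i)) + (\<Sum>i<m. V 1 (?c (k * m + i)))"
      by (simp add: add.commute[of m] sum_lessThan_add)
    then show ?case
      using Suc period[of k m] by (simp add: algebra_simps)
  qed (use x in simp)
  have "?c (k * m + j) \<in> XX" if "j \<le> m" for k j
    using period[OF _ that] updates by blast
  from this[of "n mod m" "n div m"] m show XX: "?c n \<in> XX"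
    by simp
  have sum_nonneg: "0 \<le> \<alpha> * (\<Sum>i<k * m. V 1 (?c i))" for k
  proof -
    have "?c i \<in> XX" for i
      using \<open>\<And>k j. j \<le> m \<Longrightarrow> ?c (k * m + j) \<in> XX\<close>[of "i mod m" "i div m"] m by simp
    then show ?thesis
      using \<alpha>(2) by (intro mult_nonneg_nonneg sum_nonneg value_nonneg) auto
  qed
  have "V 1 (?c ((n div m) * m + n mod m)) \<le> V N (?c ((n div m) * m))"
    using period[of "n div m" "n mod m"] updates m by simp
  also have "\<dots> \<le> V N x"
    using updates[of "n div m"] sum_nonneg[of "n div m"] by linarith
  finally show "V 1 (?c n) \<le> V N x"
    by simp
  have "0 \<le> V N (?c (n * m))"
    using updates m by (intro value_nonneg) auto
  then show "\<alpha> * (\<Sum>i<n * m. V 1 (?c i)) \<le> V N x"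
    using updates[of n] by simp
qed

end

text \<open>\<open>V N\<close> acts as a Lyapunov function at the update times. A nonnegative index
  confines the loop to a neighbourhood; a positive one makes \<open>V 1\<close> summable along the
  loop, hence convergent to 0, and \<open>\<eta>l\<close> transfers this to the distance.\<close>

lemma mpc_stability:
  fixes f :: "'x::metric_space \<Rightarrow> 'u \<Rightarrow> 'x" and M :: real
  assumes "control_problem f l XX UU"
    and \<eta>: "K_infinity \<eta>l" "K_infinity \<eta>u"
    and lower: "\<And>x. x \<in> XX \<Longrightarrow> \<eta>l (dist x xs) \<le> optimal_value f l XX UU 1 x"
    and upper: "\<And>x. x \<in> XX \<Longrightarrow> optimal_value f l XX UU N x \<le> \<eta>u (dist x xs)"
    and M: "1 < M" and m: "1 \<le> m" "m < N"
    and bound: "\<And>i y. 1 \<le> i \<Longrightarrow> y \<in> XX \<Longrightarrow>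
      optimal_value f l XX UU i y \<le> M * optimal_value f l XX UU 1 y"
    and \<mu>: "mpc_feedback f l XX UU N m \<mu>"
  shows "0 \<le> subopt_index (\<lambda>_. M) N m \<Longrightarrow> stable_at XX xs (closed_loop f \<mu> m)"
    and "0 < subopt_index (\<lambda>_. M) N m \<Longrightarrow> asymptotically_stable_at XX xs (closed_loop f \<mu> m)"
proof -
  interpret control_problem f l XX UU
    by fact
  define \<alpha> where "\<alpha> = subopt_index (\<lambda>_. M) N m"
  have far: "\<epsilon> > dist y xs" if "\<eta>l (dist y xs) < \<eta>l \<epsilon>" "0 < \<epsilon>" for y \<epsilon>
  proof (rule ccontr)
    assume "\<not> \<epsilon> > dist y xs"
    then have "\<epsilon> \<le> dist y xs"
      by simp
    then have "\<eta>l \<epsilon> \<le> \<eta>l (dist y xs)"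
      using \<eta>(1) that(2) unfolding K_infinity_def
      by (metis atLeast_iff less_eq_real_def order_trans strict_mono_onD)
    with that show False
      by simp
  qed
  have pos: "0 < \<eta>l \<epsilon>" if "0 < \<epsilon>" for \<epsilon>
    using \<eta>(1) that unfolding K_infinity_def
    by (metis atLeast_iff less_eq_real_def strict_mono_onD)
  show stable: "stable_at XX xs (closed_loop f \<mu> m)" if "0 \<le> subopt_index (\<lambda>_. M) N m"
    unfolding stable_at_def
  proof (intro allI impI)
    fix \<epsilon> :: real assume "0 < \<epsilon>"
    have "continuous_on {0..} \<eta>u" "\<eta>u 0 = 0"
      using \<eta>(2) by (auto simp: K_infinity_def)
    \<comment> \<open>Continuity of \<open>\<eta>u\<close> at 0, with the positive number
      \<open>\<eta>l \<epsilon>\<close> as tolerance.\<close>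
    then obtain \<delta> where "0 < \<delta>" and \<delta>: "\<And>r. 0 \<le> r \<Longrightarrow> r < \<delta> \<Longrightarrow> \<bar>\<eta>u r\<bar> < \<eta>l \<epsilon>"
      using pos[OF \<open>0 < \<epsilon>\<close>] unfolding continuous_on_iff dist_real_def
      by (metis abs_of_nonneg atLeast_iff diff_zero order_refl)
    have "dist (closed_loop f \<mu> m x n) xs < \<epsilon>" if "x \<in> XX" "dist x xs < \<delta>" for x n
    proof (rule far[OF _ \<open>0 < \<epsilon>\<close>])
      note cl = closed_loop_decrease[OF \<mu> \<open>x \<in> XX\<close> M m bound \<alpha>_def, of n]
      have "0 \<le> \<alpha>"
        using \<open>0 \<le> subopt_index (\<lambda>_. M) N m\<close> by (simp add: \<alpha>_def)
      then have "\<eta>l (dist (closed_loop f \<mu> m x n) xs) \<le> V N x"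
        using cl lower order_trans by blast
      also have "\<dots> \<le> \<eta>u (dist x xs)"
        using upper that by simp
      also have "\<dots> < \<eta>l \<epsilon>"
        using \<delta>[of "dist x xs"] that by simp
      finally show "\<eta>l (dist (closed_loop f \<mu> m x n) xs) < \<eta>l \<epsilon>" .
    qed
    with \<open>0 < \<delta>\<close> show "\<exists>\<delta>>0. \<forall>x\<in>XX. dist x xs < \<delta> \<longrightarrow>
        (\<forall>n. dist (closed_loop f \<mu> m x n) xs < \<epsilon>)"
      by blast
  qed
  show "asymptotically_stable_at XX xs (closed_loop f \<mu> m)" if "0 < subopt_index (\<lambda>_. M) N m"
    unfolding asymptotically_stable_at_def
  proof (intro conjI ballI)
    show "stable_at XX xs (closed_loop f \<mu> m)"
      using stable that by simp
    fix x assume "x \<in> XX"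
    let ?c = "closed_loop f \<mu> m x"
    have "0 < \<alpha>"
      using that by (simp add: \<alpha>_def)
    note cl = closed_loop_decrease[OF \<mu> \<open>x \<in> XX\<close> M m bound \<alpha>_def less_imp_le[OF \<open>0 < \<alpha>\<close>]]
    have nonneg: "0 \<le> V 1 (?c i)" for i
      using cl(2) by (intro value_nonneg) auto
    have "(\<Sum>i<n. V 1 (?c i)) \<le> V N x / \<alpha>" for n
    proof -
      \<comment> \<open>The decrease is known over whole periods only; since
        \<open>1 \<le> m\<close>, the first \<open>n\<close> periods contain the first
        \<open>n\<close> steps.\<close>
      have "(\<Sum>i<n. V 1 (?c i)) \<le> (\<Sum>i<n * m. V 1 (?c i))"
        using m nonneg by (intro sum_mono2) auto
      also have "\<dots> \<le> V N x / \<alpha>"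
        using cl(3)[of n] \<open>0 < \<alpha>\<close> by (simp add: pos_le_divide_eq mult.commute)
      finally show ?thesis .
    qed
    with nonneg have "summable (\<lambda>i. V 1 (?c i))"
      by (intro bounded_imp_summable[of _ "V N x / \<alpha>"]) (auto simp flip: lessThan_Suc_atMost simp del: sum.lessThan_Suc)
    then have lim: "(\<lambda>i. V 1 (?c i)) \<longlonglongrightarrow> 0"
      by (rule summable_LIMSEQ_zero)
    show "?c \<longlonglongrightarrow> xs"
    proof (rule tendstoI)
      fix \<epsilon> :: real assume "0 < \<epsilon>"
      have "\<forall>\<^sub>F n in sequentially. V 1 (?c n) < \<eta>l \<epsilon>"
        using order_tendstoD(2)[OF lim pos[OF \<open>0 < \<epsilon>\<close>]] .
      then show "\<forall>\<^sub>F n in sequentially. dist (?c n) xs < \<epsilon>"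
      proof eventually_elim
        case (elim n)
        then show ?case
          using lower[OF cl(2)[of n]] by (intro far[OF _ \<open>0 < \<epsilon>\<close>]) simp
      qed
    qed
  qed
qed

section \<open>Minimal stabilizing horizons\<close>

lemma power_le_iff_ln:
  fixes q c :: real
  assumes "0 < q" "0 < c"
  shows "q ^ n \<le> c \<longleftrightarrow> real n * ln q \<le> ln c" and "q ^ n < c \<longleftrightarrow> real n * ln q < ln c"
  using assms by (metis ln_le_cancel_iff ln_realpow zero_less_power,
      metis ln_less_cancel_iff ln_realpow zero_less_power)

lemma ln_gap_pos: "1 < M \<Longrightarrow> 0 < ln M - ln (M - 1)" for M :: real
  by simp

text \<open>The criterion \<open>q + q ^ (N - 1) \<le> 1\<close> says
  \<open>q ^ (N - 1) \<le> 1 / M\<close>, and logarithms give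
  \<open>ln M \<le> (N - 1) * (ln M - ln (M - 1))\<close>. Writing \<open>ln M\<close> as
  \<open>ln (M - 1)\<close> plus the gap turns the 1 into the constant 2 of the bound.\<close>

lemma one_step_bound_iff:
  assumes "1 < M" "2 \<le> N"
  shows "0 \<le> subopt_index (\<lambda>_. M) N 1 \<longleftrightarrow> one_step_bound M \<le> real N"
    and "0 < subopt_index (\<lambda>_. M) N 1 \<longleftrightarrow> one_step_bound M < real N"
proof -
  define q where "q = (M - 1) / M"
  have q: "0 < q" "ln q = - (ln M - ln (M - 1))"
    using assms by (auto simp: q_def ln_div)
  have "1 - q = 1 / M"
    using assms by (simp add: q_def field_simps)
  then have "q ^ 1 + q ^ (N - 1) \<le> 1 \<longleftrightarrow> q ^ (N - 1) \<le> 1 / M"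
    and "q ^ 1 + q ^ (N - 1) < 1 \<longleftrightarrow> q ^ (N - 1) < 1 / M"
    by auto
  then have "q ^ 1 + q ^ (N - 1) \<le> 1 \<longleftrightarrow> one_step_bound M \<le> real N"
    and "q ^ 1 + q ^ (N - 1) < 1 \<longleftrightarrow> one_step_bound M < real N"
    using assms ln_gap_pos[of M] power_le_iff_ln[OF q(1), of "1 / M" "N - 1"]
    unfolding q(2) one_step_bound_def by (auto simp: field_simps ln_div of_nat_diff)
  then show "0 \<le> subopt_index (\<lambda>_. M) N 1 \<longleftrightarrow> one_step_bound M \<le> real N"
    and "0 < subopt_index (\<lambda>_. M) N 1 \<longleftrightarrow> one_step_bound M < real N"
    using subopt_index_const_sign[OF assms(1) q_def, of 1 N] assms(2) by auto
qed

text \<open>Rewrites the odd bound as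
  \<open>2 * ln ((2 * M - 1) / M) / (ln M - ln (M - 1)) + 1\<close>, which compares directly with
  \<open>N = 2 * k + 1\<close>.\<close>

lemma ln_odd_factor:
  fixes M :: real
  assumes "1 < M"
  shows "ln ((2 * M - 1) / (M - 1)) = ln ((2 * M - 1) / M) + (ln M - ln (M - 1))"
  using assms by (simp add: ln_div)

lemma half_horizon_bound_iff:
  assumes "1 < M" "2 \<le> N"
  shows "0 \<le> subopt_index (\<lambda>_. M) N (N div 2) \<longleftrightarrow> half_horizon_bound M N \<le> real N"
    and "0 < subopt_index (\<lambda>_. M) N (N div 2) \<longleftrightarrow> half_horizon_bound M N < real N"
proof -
  define q where "q = (M - 1) / M"
  define k where "k = N div 2"
  have q: "0 < q" "ln q = - (ln M - ln (M - 1))"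
    using assms by (auto simp: q_def ln_div)
  have "(q ^ k + q ^ (N - k) \<le> 1 \<longleftrightarrow> half_horizon_bound M N \<le> real N) \<and>
      (q ^ k + q ^ (N - k) < 1 \<longleftrightarrow> half_horizon_bound M N < real N)"
  proof (cases "even N")
    case True
    then have N: "N = 2 * k"
      by (simp add: k_def)
    have "q ^ k + q ^ (N - k) \<le> 1 \<longleftrightarrow> q ^ k \<le> 1 / 2"
      and "q ^ k + q ^ (N - k) < 1 \<longleftrightarrow> q ^ k < 1 / 2"
      by (auto simp: N)
    then show ?thesis
      using assms ln_gap_pos[of M] power_le_iff_ln[OF q(1), of "1 / 2" k] True
      unfolding q(2) half_horizon_bound_def by (auto simp: N field_simps ln_div)
  next
    case False
    then have N: "N = 2 * k + 1"
      by (simp add: k_def)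
    \<comment> \<open>Here \<open>N - k = k + 1\<close>, and
      \<open>1 + q = (2 * M - 1) / M\<close>.\<close>
    have "q ^ k + q ^ (N - k) = q ^ k * ((2 * M - 1) / M)"
      using assms by (simp add: N q_def field_simps)
    moreover have "0 < (2 * M - 1) / M" "M / (2 * M - 1) = 1 / ((2 * M - 1) / M)"
      using assms by auto
    ultimately have "q ^ k + q ^ (N - k) \<le> 1 \<longleftrightarrow> q ^ k \<le> M / (2 * M - 1)"
      and "q ^ k + q ^ (N - k) < 1 \<longleftrightarrow> q ^ k < M / (2 * M - 1)"
      by (simp_all only: pos_le_divide_eq pos_less_divide_eq)
    then have "q ^ k + q ^ (N - k) \<le> 1 \<longleftrightarrow> ln ((2 * M - 1) / M) \<le> real k * (ln M - ln (M - 1))"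
      and "q ^ k + q ^ (N - k) < 1 \<longleftrightarrow> ln ((2 * M - 1) / M) < real k * (ln M - ln (M - 1))"
      using assms power_le_iff_ln[OF q(1), of "M / (2 * M - 1)" k]
      unfolding q(2) by (auto simp: ln_div algebra_simps)
    then show ?thesis
      using ln_gap_pos[OF assms(1)] False
      unfolding half_horizon_bound_def ln_odd_factor[OF assms(1)]
      by (auto simp: pos_divide_le_eq pos_divide_less_eq N algebra_simps)
  qed
  then show "0 \<le> subopt_index (\<lambda>_. M) N (N div 2) \<longleftrightarrow> half_horizon_bound M N \<le> real N"
    and "0 < subopt_index (\<lambda>_. M) N (N div 2) \<longleftrightarrow> half_horizon_bound M N < real N"
    using subopt_index_const_sign[OF assms(1) q_def, of k N] assms(2) by (auto simp: k_def)
qed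

text \<open>The horizon \<open>N\<close> is the witness without which \<open>LEAST\<close> would be
  unspecified.\<close>

lemma min_horizon_properties:
  assumes "2 \<le> N" "0 \<le> subopt_index \<gamma> N (m N)"
  shows "2 \<le> min_horizon \<gamma> m"
    and "0 \<le> subopt_index \<gamma> (min_horizon \<gamma> m) (m (min_horizon \<gamma> m))"
    and "min_horizon \<gamma> m \<le> N"
  unfolding min_horizon_def
  using LeastI[of "\<lambda>N. 2 \<le> N \<and> 0 \<le> subopt_index \<gamma> N (m N)" N] assms
  by (auto intro: Least_le)

lemma one_step_horizon_exists:
  assumes "1 < M"
  obtains N where "2 \<le> N" "0 \<le> subopt_index (\<lambda>_. M) N 1" "real N \<le> max 2 (one_step_bound M + 1)"
proof
  \<comment> \<open>The maximum matters for \<open>M < 2\<close>, where \<open>ln (M - 1)\<close> is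
    negative and the bound drops below 2.\<close>
  let ?N = "max 2 (nat \<lceil>one_step_bound M\<rceil>)"
  show "2 \<le> ?N"
    by simp
  moreover have "one_step_bound M \<le> real ?N"
    by linarith
  ultimately show "0 \<le> subopt_index (\<lambda>_. M) ?N 1"
    using one_step_bound_iff(1)[OF assms, of ?N] by blast
  show "real ?N \<le> max 2 (one_step_bound M + 1)"
    by linarith
qed

lemma half_horizon_exists:
  assumes "1 < M"
  obtains N where "2 \<le> N" "0 \<le> subopt_index (\<lambda>_. M) N (N div 2)"
    "real N \<le> 2 * ln 2 / (ln M - ln (M - 1)) + 2"
proof
  define b where "b = ln 2 / (ln M - ln (M - 1))"
  \<comment> \<open>An even horizon is chosen so that the simpler even bound applies; rounding then
    costs at most 2.\<close>
  let ?N = "2 * nat \<lceil>b\<rceil>"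
  have b: "0 < b"
    using ln_gap_pos[OF assms] by (simp add: b_def)
  then have "0 < nat \<lceil>b\<rceil>"
    by simp
  then show "2 \<le> ?N"
    by linarith
  moreover have "2 * b \<le> real ?N"
    by linarith
  then have "half_horizon_bound M ?N \<le> real ?N"
    by (simp add: half_horizon_bound_def b_def)
  ultimately show "0 \<le> subopt_index (\<lambda>_. M) ?N (?N div 2)"
    using half_horizon_bound_iff(1)[OF assms, of ?N] by blast
  have "real ?N \<le> 2 * b + 2"
    using b by linarith
  then show "real ?N \<le> 2 * ln 2 / (ln M - ln (M - 1)) + 2"
    by (simp add: b_def)
qed

text \<open>The minimal horizon may be odd, so its lower estimate must cover both parities. The odd
  case rests on \<open>(2 * M - 1)\<^sup>2 \<ge> 4 * M * (M - 1)\<close>.\<close>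

lemma half_horizon_bound_ge_even:
  assumes "1 < M"
  shows "2 * ln 2 / (ln M - ln (M - 1)) \<le> half_horizon_bound M N"
proof (cases "even N")
  case False
  have "2 * ln 2 = ln (4::real)"
    using ln_realpow[of 2 2] by simp
  also have "\<dots> \<le> ln ((2 * M - 1) / M * ((2 * M - 1) / (M - 1)))"
    using assms by (intro ln_mono) (auto simp: field_simps)
  also have "\<dots> = ln ((2 * M - 1) / M) + ln ((2 * M - 1) / (M - 1))"
    using assms by (intro ln_mult_pos) auto
  finally show ?thesis
    using False ln_gap_pos[OF assms] by (simp add: half_horizon_bound_def divide_right_mono)
qed (simp add: half_horizon_bound_def)

section \<open>Growth of the minimal horizons\<close>

lemma min_horizon_one_step_asymptotics:
  "(\<lambda>C::real. real (min_horizon (\<lambda>_. C) (\<lambda>_. 1))) \<sim>[at_top] (\<lambda>C. C * ln C)"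
proof (rule asymp_equiv_sandwich_real)
  show "one_step_bound \<sim>[at_top] (\<lambda>C. C * ln C)"
    unfolding one_step_bound_def by real_asymp
  show "(\<lambda>C. one_step_bound C + 1) \<sim>[at_top] (\<lambda>C. C * ln C)"
    unfolding one_step_bound_def by real_asymp
  show "\<forall>\<^sub>F C in at_top. real (min_horizon (\<lambda>_. C) (\<lambda>_. 1)) \<in> {one_step_bound C..one_step_bound C + 1}"
    using eventually_ge_at_top[of "2::real"]
  proof eventually_elim
    case (elim C)
    then have "1 < C"
      by simp
    \<comment> \<open>For \<open>C \<ge> 2\<close> the maximum in the upper estimate reduces to
      \<open>one_step_bound C + 1\<close>.\<close>
    have "2 \<le> one_step_bound C"
      using elim ln_gap_pos[OF \<open>1 < C\<close>] by (simp add: one_step_bound_def)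
    obtain N where N: "2 \<le> N" "0 \<le> subopt_index (\<lambda>_. C) N 1" "real N \<le> max 2 (one_step_bound C + 1)"
      using one_step_horizon_exists[OF \<open>1 < C\<close>] .
    note min = min_horizon_properties[of N "\<lambda>_. C" "\<lambda>_. 1", OF N(1,2)]
    have "one_step_bound C \<le> real (min_horizon (\<lambda>_. C) (\<lambda>_. 1))"
      using one_step_bound_iff(1)[OF \<open>1 < C\<close> min(1)] min(2) by simp
    moreover have "real (min_horizon (\<lambda>_. C) (\<lambda>_. 1)) \<le> one_step_bound C + 1"
      using min(3) N(3) \<open>2 \<le> one_step_bound C\<close> by linarith
    ultimately show ?case
      by simp
  qed
qed

lemma min_horizon_half_asymptotics:
  "(\<lambda>C::real. real (min_horizon (\<lambda>_. C) (\<lambda>n. n div 2))) \<sim>[at_top] (\<lambda>C. 2 * ln 2 * C)"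
proof (rule asymp_equiv_sandwich_real)
  \<comment> \<open>The gap \<open>ln C - ln (C - 1)\<close> behaves like \<open>1 / C\<close>. The
    even bound serves as lower estimate for both parities, and with 2 added as upper
    estimate.\<close>
  show "(\<lambda>C. 2 * ln 2 / (ln C - ln (C - 1))) \<sim>[at_top] (\<lambda>C::real. 2 * ln 2 * C)"
    by real_asymp
  show "(\<lambda>C. 2 * ln 2 / (ln C - ln (C - 1)) + 2) \<sim>[at_top] (\<lambda>C::real. 2 * ln 2 * C)"
    by real_asymp
  show "\<forall>\<^sub>F C in at_top. real (min_horizon (\<lambda>_. C) (\<lambda>n. n div 2)) \<in>
      {2 * ln 2 / (ln C - ln (C - 1))..2 * ln 2 / (ln C - ln (C - 1)) + 2}"
    using eventually_gt_at_top[of "1::real"]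
  proof eventually_elim
    case (elim C)
    obtain N where N: "2 \<le> N" "0 \<le> subopt_index (\<lambda>_. C) N (N div 2)"
      "real N \<le> 2 * ln 2 / (ln C - ln (C - 1)) + 2"
      using half_horizon_exists[OF elim] .
    note min = min_horizon_properties[of N "\<lambda>_. C" "\<lambda>n. n div 2", OF N(1,2)]
    have "2 * ln 2 / (ln C - ln (C - 1)) \<le> real (min_horizon (\<lambda>_. C) (\<lambda>n. n div 2))"
      using half_horizon_bound_ge_even[OF elim] half_horizon_bound_iff(1)[OF elim min(1)] min(2)
        order_trans by blast
    moreover have "real (min_horizon (\<lambda>_. C) (\<lambda>n. n div 2)) \<le> 2 * ln 2 / (ln C - ln (C - 1)) + 2"
      using min(3) N(3) by linarith
    ultimately show ?case
      by simp
  qed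
qed

text \<open>By \<open>subopt_index_nonneg_mono\<close> the minimal horizon for the constant
  \<open>M\<close> is itself a candidate for \<gamma>; \<open>N\<close> guarantees that it is
  attained.\<close>

lemma min_horizon_mono:
  fixes \<gamma> :: "nat \<Rightarrow> real" and M :: real
  assumes "1 < M" "\<And>i. 1 \<le> i \<Longrightarrow> 1 \<le> \<gamma> i" "\<And>i. 1 \<le> i \<Longrightarrow> \<gamma> i \<le> M"
    and m: "\<And>n. 2 \<le> n \<Longrightarrow> 1 \<le> m n \<and> m n < n"
    and N: "2 \<le> N" "0 \<le> subopt_index (\<lambda>_. M) N (m N)"
  shows "min_horizon \<gamma> m \<le> min_horizon (\<lambda>_. M) m"
proof (rule min_horizon_properties(3))
  note min = min_horizon_properties[of N "\<lambda>_. M" m, OF N]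
  show "2 \<le> min_horizon (\<lambda>_. M) m"
    by (fact min(1))
  show "0 \<le> subopt_index \<gamma> (min_horizon (\<lambda>_. M) m) (m (min_horizon (\<lambda>_. M) m))"
    using m[OF min(1)] by (intro subopt_index_nonneg_mono[OF assms(1) _ _ assms(2,3) min(2)]) auto
qed

text \<open>Growth is stated in a separate variable \<open>C\<close>, as \<open>M\<close> is fixed.
  For bounded sequences, stability reduces to the constant \<open>M\<close>, whereas the indices are
  compared factor by factor, under \<open>1 \<le> \<gamma> i\<close>.\<close>

theorem proposition6:
  fixes f :: "'x::metric_space \<Rightarrow> 'u::metric_space \<Rightarrow> 'x"
    and l :: "'x \<Rightarrow> 'u \<Rightarrow> real"
    and XX :: "'x set" and UU :: "'u set"
    and xs :: 'x and us :: 'u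
    and \<eta>l \<eta>u :: "real \<Rightarrow> real"
    and M :: real and N :: nat
  assumes equilibrium: "xs \<in> XX" "f xs us = xs"
    and l_continuous: "continuous_on UNIV (\<lambda>(x, u). l x u)"
    and l_nonneg: "\<And>x u. 0 \<le> l x u"
    and l_zero: "l xs us = 0"
    and l_pos: "\<And>x u. x \<noteq> xs \<Longrightarrow> 0 < l x u"
    and minimizer_exists: "\<And>x i. x \<in> XX \<Longrightarrow> 1 \<le> i \<Longrightarrow> \<exists>u. optimal_control f l XX UU i x u"
    and M: "1 < M" and N: "2 \<le> N"
    and \<eta>: "K_infinity \<eta>l" "K_infinity \<eta>u"
    and lower: "\<And>x. x \<in> XX \<Longrightarrow> \<eta>l (dist x xs) \<le> optimal_value f l XX UU 1 x"
    and upper: "\<And>x. x \<in> XX \<Longrightarrow> optimal_value f l XX UU N x \<le> \<eta>u (dist x xs)"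
  shows
    \<comment> \<open>the constant sequence M\<close>
    "((\<forall>i\<ge>1. \<forall>x\<in>XX. optimal_value f l XX UU i x \<le> M * optimal_value f l XX UU 1 x) \<longrightarrow>
       (\<forall>\<mu>. mpc_feedback f l XX UU N 1 \<mu> \<longrightarrow>
          (one_step_bound M \<le> real N \<longrightarrow> stable_at XX xs (closed_loop f \<mu> 1)) \<and>
          (one_step_bound M < real N \<longrightarrow> asymptotically_stable_at XX xs (closed_loop f \<mu> 1))) \<and>
       (\<forall>\<mu>. mpc_feedback f l XX UU N (N div 2) \<mu> \<longrightarrow>
          (half_horizon_bound M N \<le> real N \<longrightarrow>
             stable_at XX xs (closed_loop f \<mu> (N div 2))) \<and>
          (half_horizon_bound M N < real N \<longrightarrow>
             asymptotically_stable_at XX xs (closed_loop f \<mu> (N div 2)))))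
     \<and> (one_step_bound M \<le> real N \<longrightarrow> 0 \<le> subopt_index (\<lambda>_. M) N 1)
     \<and> (half_horizon_bound M N \<le> real N \<longrightarrow> 0 \<le> subopt_index (\<lambda>_. M) N (N div 2))
     \<and> (\<lambda>C::real. real (min_horizon (\<lambda>_. C) (\<lambda>_. 1))) \<sim>[at_top] (\<lambda>C. C * ln C)
     \<and> (\<lambda>C::real. real (min_horizon (\<lambda>_. C) (\<lambda>n. n div 2))) \<sim>[at_top] (\<lambda>C. 2 * ln 2 * C)
     \<and> \<comment> \<open>sequences bounded by M\<close>
       (\<forall>\<gamma> :: nat \<Rightarrow> real. (\<forall>i\<ge>1. \<gamma> i \<le> M) \<longrightarrow>
          ((\<forall>i\<ge>1. \<forall>x\<in>XX. optimal_value f l XX UU i x \<le> \<gamma> i * optimal_value f l XX UU 1 x) \<longrightarrow>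
             (\<forall>\<mu>. mpc_feedback f l XX UU N 1 \<mu> \<longrightarrow>
                (one_step_bound M \<le> real N \<longrightarrow> stable_at XX xs (closed_loop f \<mu> 1)) \<and>
                (one_step_bound M < real N \<longrightarrow>
                   asymptotically_stable_at XX xs (closed_loop f \<mu> 1))) \<and>
             (\<forall>\<mu>. mpc_feedback f l XX UU N (N div 2) \<mu> \<longrightarrow>
                (half_horizon_bound M N \<le> real N \<longrightarrow>
                   stable_at XX xs (closed_loop f \<mu> (N div 2))) \<and>
                (half_horizon_bound M N < real N \<longrightarrow>
                   asymptotically_stable_at XX xs (closed_loop f \<mu> (N div 2))))) \<and>
          ((\<forall>i\<ge>1. 1 \<le> \<gamma> i) \<longrightarrow>
             (one_step_bound M \<le> real N \<longrightarrow> 0 \<le> subopt_index \<gamma> N 1) \<and>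
             (half_horizon_bound M N \<le> real N \<longrightarrow> 0 \<le> subopt_index \<gamma> N (N div 2)) \<and>
             min_horizon \<gamma> (\<lambda>_. 1) \<le> min_horizon (\<lambda>_. M) (\<lambda>_. 1) \<and>
             min_horizon \<gamma> (\<lambda>n. n div 2) \<le> min_horizon (\<lambda>_. M) (\<lambda>n. n div 2)))"
proof -
  have problem: "control_problem f l XX UU"
    using l_nonneg minimizer_exists by unfold_locales
  interpret control_problem f l XX UU
    by (fact problem)
  have half: "1 \<le> N div 2" "N div 2 < N" and one: "1 \<le> (1::nat)" "1 < N"
    using N by auto
  note one_iff = one_step_bound_iff[OF M N] and half_iff = half_horizon_bound_iff[OF M N]
  have bounded: "(\<forall>\<mu>. mpc_feedback f l XX UU N 1 \<mu> \<longrightarrow>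
          (one_step_bound M \<le> real N \<longrightarrow> stable_at XX xs (closed_loop f \<mu> 1)) \<and>
          (one_step_bound M < real N \<longrightarrow> asymptotically_stable_at XX xs (closed_loop f \<mu> 1))) \<and>
       (\<forall>\<mu>. mpc_feedback f l XX UU N (N div 2) \<mu> \<longrightarrow>
          (half_horizon_bound M N \<le> real N \<longrightarrow>
             stable_at XX xs (closed_loop f \<mu> (N div 2))) \<and>
          (half_horizon_bound M N < real N \<longrightarrow>
             asymptotically_stable_at XX xs (closed_loop f \<mu> (N div 2))))"
    if bound: "\<forall>i\<ge>1. \<forall>x\<in>XX. V i x \<le> \<gamma> i * V 1 x" and \<gamma>: "\<forall>i\<ge>1. \<gamma> i \<le> M" for \<gamma>
  proof -
    have "V i y \<le> M * V 1 y" if "1 \<le> i" "y \<in> XX" for i y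
    proof -
      have "V i y \<le> \<gamma> i * V 1 y"
        using bound that by blast
      \<comment> \<open>Nonnegativity of \<open>V 1\<close> lets \<gamma> i be replaced by its
        bound, so the constant case covers every bounded sequence.\<close>
      also have "\<dots> \<le> M * V 1 y"
        using \<gamma> that by (intro mult_right_mono value_nonneg) auto
      finally show ?thesis .
    qed
    note stability = mpc_stability[OF problem \<eta> lower upper M _ _ this]
    show ?thesis
      using stability[OF _ _ one] stability[OF _ _ half] one_iff half_iff by blast
  qed
  have index_nonneg: "(one_step_bound M \<le> real N \<longrightarrow> 0 \<le> subopt_index \<gamma> N 1) \<and>
             (half_horizon_bound M N \<le> real N \<longrightarrow> 0 \<le> subopt_index \<gamma> N (N div 2)) \<and>
             min_horizon \<gamma> (\<lambda>_. 1) \<le> min_horizon (\<lambda>_. M) (\<lambda>_. 1) \<and>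
             min_horizon \<gamma> (\<lambda>n. n div 2) \<le> min_horizon (\<lambda>_. M) (\<lambda>n. n div 2)"
    if "\<forall>i\<ge>1. \<gamma> i \<le> M" "\<forall>i\<ge>1. 1 \<le> \<gamma> i" for \<gamma>
  proof (intro conjI impI)
    have \<gamma>: "\<And>i. 1 \<le> i \<Longrightarrow> 1 \<le> \<gamma> i" "\<And>i. 1 \<le> i \<Longrightarrow> \<gamma> i \<le> M"
      using that by auto
    show "0 \<le> subopt_index \<gamma> N 1" if "one_step_bound M \<le> real N"
      using that one_iff by (intro subopt_index_nonneg_mono[OF M one \<gamma>]) auto
    show "0 \<le> subopt_index \<gamma> N (N div 2)" if "half_horizon_bound M N \<le> real N"
      using that half_iff by (intro subopt_index_nonneg_mono[OF M half \<gamma>]) auto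
    obtain N1 where "2 \<le> N1" "0 \<le> subopt_index (\<lambda>_. M) N1 1"
      using one_step_horizon_exists[OF M] by blast
    then show "min_horizon \<gamma> (\<lambda>_. 1) \<le> min_horizon (\<lambda>_. M) (\<lambda>_. 1)"
      by (intro min_horizon_mono[OF M \<gamma>]) auto
    obtain N2 where "2 \<le> N2" "0 \<le> subopt_index (\<lambda>_. M) N2 (N2 div 2)"
      using half_horizon_exists[OF M] by blast
    then show "min_horizon \<gamma> (\<lambda>n. n div 2) \<le> min_horizon (\<lambda>_. M) (\<lambda>n. n div 2)"
      by (intro min_horizon_mono[OF M \<gamma>, where N = N2]) auto
  qed
  show ?thesis
    using bounded[of "\<lambda>_. M"] bounded index_nonneg one_iff half_iff
      min_horizon_one_step_asymptotics min_horizon_half_asymptotics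
    by (intro conjI allI impI) blast+
qed

end
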